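(* Let $\Omega=(V,E)$ be a non-bipartite connected simple graph (no loops, no multiple edges) with vertex set $V=\{v_1,\dots,v_n\}$ and edge set $E=\{e_1,\dots,e_m\}$, where $m\geq n$. Let $W=BD^{-1}\in\mathbb{R}^{m\times n}$ be its weighted signless edge-vertex incidence matrix. Then $$\mu_{\infty}(\Omega)=\min_{\|X\|_{\infty}=1}\|WX\|_{\infty}=\frac{1}{\min\limits_{WGW=W}\|G\|_{\infty,\infty}},$$ where the minimum in the denominator is over all real $n\times m$ matrices $G$ with $WGW=W$.
   Context: The edge-vertex incidence matrix $B=(b_{ij})\in\mathbb{R}^{m\times n}$ has $b_{ij}=1$ if $v_j$ is incident to $e_i$ and $b_{ij}=0$ otherwise. $D=\mathrm{diag}(d_1,\dots,d_n)$ where $d_i$ is the degree of $v_i$. The smallest normalized signless $\infty$-Laplacian eigenvalue is $\mu_\infty(\Omega)=\min_{\|X\|_\infty=1}\|WX\|_\infty=\min_{\|X\|_\infty=1}\max_{v_i\sim v_j}\left|\frac{x_i}{d_i}+\frac{x_j}{d_j}\right|$ for $X=(x_1,\dots,x_n)^{\mathrm T}\in\mathbb{R}^n$. For $x\in\mathbb{R}^n$, $\|x\|_\infty=\max_i|x_i|$, and for a real matrix $A=(a_{ij})$ with $m$ rows, $\|A\|_{\infty,\infty}=\max\{\|AX\|_\infty:\|X\|_\infty=1\}=\max_i\sum_j|a_{ij}|$. A real $n\times m$ matrix $G$ is a generalized inverse of $W$ if $WGW=W$. *)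

theory Defs
  imports "HOL-Analysis.Analysis"
begin

text \<open>
  Graphs have the whole (finite, nonempty) type \<open>'v\<close> as vertex set and are given by their set \<open>E\<close>
  of edges, which are two-element sets of vertices; so there are no loops and no multiple edges.
\<close>

definition simple_graph :: "'v::finite set set \<Rightarrow> bool" where
  "simple_graph E \<longleftrightarrow> (\<forall>e\<in>E. card e = 2)"

definition connected_graph :: "'v::finite set set \<Rightarrow> bool" where
  "connected_graph E \<longleftrightarrow> (\<forall>u v. (u, v) \<in> {(a, b). {a, b} \<in> E}\<^sup>*)"

definition bipartite_graph :: "'v::finite set set \<Rightarrow> bool" where
  "bipartite_graph E \<longleftrightarrow>
    (\<exists>P Q. P \<union> Q = UNIV \<and> P \<inter> Q = {} \<and> (\<forall>e\<in>E. \<exists>p\<in>P. \<exists>q\<in>Q. e = {p, q}))"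

definition vertex_degree :: "'v::finite set set \<Rightarrow> 'v \<Rightarrow> nat" where
  "vertex_degree E v = card {e \<in> E. v \<in> e}"

text \<open>
  The type \<open>'m\<close> indexes the edges \<open>e\<^sub>1, \<dots>, e\<^sub>m\<close>: below, \<open>e :: 'm \<Rightarrow> 'v set\<close> is an enumeration of
  the edge set, i.e. a bijection from \<open>'m\<close> onto \<open>E\<close>.  An \<open>m \<times> n\<close> matrix has type \<open>real^'v^'m\<close>.
\<close>

definition incidence_matrix :: "('m::finite \<Rightarrow> 'v::finite set) \<Rightarrow> real^'v^'m" where
  "incidence_matrix e = (\<chi> i j. if j \<in> e i then 1 else 0)"

definition degree_matrix :: "'v::finite set set \<Rightarrow> real^'v^'v" where
  "degree_matrix E = (\<chi> i j. if i = j then real (vertex_degree E i) else 0)"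

definition weighted_incidence_matrix :: "('m::finite \<Rightarrow> 'v::finite set) \<Rightarrow> real^'v^'m" where
  "weighted_incidence_matrix e = incidence_matrix e ** matrix_inv (degree_matrix (range e))"

definition is_minimum :: "real set \<Rightarrow> real \<Rightarrow> bool" where
  "is_minimum S a \<longleftrightarrow> a \<in> S \<and> (\<forall>s\<in>S. a \<le> s)"

text \<open>
  The smallest normalized signless \<open>\<infinity>\<close>-Laplacian eigenvalue, written in terms of the graph alone.
  The vector norm \<open>\<parallel>X\<parallel>\<^sub>\<infinity>\<close> is \<^const>\<open>infnorm\<close>.  The minimum is rendered as an infimum here, and its
  attainment is part of the theorem.
\<close>

definition mu_infinity :: "'v::finite set set \<Rightarrow> real" where
  "mu_infinity E =
    (INF X\<in>{X :: real^'v. infnorm X = 1}.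
      Max {\<bar>X $ i / vertex_degree E i + X $ j / vertex_degree E j\<bar> | i j. {i, j} \<in> E})"

text \<open>
  The supremum below is a maximum, and equals the largest absolute row sum; see
  \<open>inf_norm_matrix_row_sum\<close> and \<open>inf_norm_matrix_attained\<close>.
\<close>

definition inf_norm_matrix :: "real^'c::finite^'r::finite \<Rightarrow> real" where
  "inf_norm_matrix A = (SUP X\<in>{X. infnorm X = 1}. infnorm (A *v X))"

lemma infnorm_eq_Max: "infnorm (x :: real^'c::finite) = Max (range (\<lambda>i. \<bar>x $ i\<bar>))"
proof -
  have "{\<bar>x $ i\<bar> | i. i \<in> UNIV} = range (\<lambda>i. \<bar>x $ i\<bar>)" by auto
  then show ?thesis by (simp add: infnorm_cart cSup_eq_Max)
qed

lemma row_sum_norming_vector: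
  fixes A :: "real^'c::finite^'r::finite"
  shows "\<exists>X. infnorm X = 1 \<and> infnorm (A *v X) = Max (range (\<lambda>i. \<Sum>j\<in>UNIV. \<bar>A $ i $ j\<bar>))"
    and "infnorm X = 1 \<Longrightarrow> infnorm (A *v X) \<le> Max (range (\<lambda>i. \<Sum>j\<in>UNIV. \<bar>A $ i $ j\<bar>))"
proof -
  let ?R = "\<lambda>i. \<Sum>j\<in>UNIV. \<bar>A $ i $ j\<bar>"
  let ?M = "Max (range ?R)"
  have le: "infnorm (A *v X) \<le> ?M" if X: "infnorm X = 1" for X
  proof -
    have X1: "\<bar>X $ j\<bar> \<le> 1" for j
      using X Max_ge[of "range (\<lambda>i. \<bar>X $ i\<bar>)" "\<bar>X $ j\<bar>"] by (simp add: infnorm_eq_Max)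
    have "\<bar>(A *v X) $ i\<bar> \<le> ?M" for i
    proof -
      have "\<bar>(A *v X) $ i\<bar> \<le> (\<Sum>j\<in>UNIV. \<bar>A $ i $ j * X $ j\<bar>)"
        by (simp add: matrix_vector_mult_def)
      also have "\<dots> \<le> ?R i"
        by (intro sum_mono) (use X1 in \<open>auto simp: abs_mult intro: mult_left_le\<close>)
      also have "\<dots> \<le> ?M" by (rule Max_ge) auto
      finally show ?thesis .
    qed
    then show ?thesis by (subst infnorm_eq_Max) auto
  qed
  then show "infnorm X = 1 \<Longrightarrow> infnorm (A *v X) \<le> ?M" .
  have "?M \<in> range ?R" by (rule Max_in) auto
  then obtain i where i: "?M = ?R i" by blast
  define X :: "real^'c" where "X = (\<chi> j. if A $ i $ j < 0 then -1 else 1)"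
  have "range (\<lambda>j. \<bar>X $ j\<bar>) = {1}" by (auto simp: X_def)
  then have X: "infnorm X = 1" by (simp only: infnorm_eq_Max Max_singleton)
  have "(A *v X) $ i = ?R i"
    by (auto simp: matrix_vector_mult_def X_def intro!: sum.cong)
  then have "?M \<le> \<bar>(A *v X) $ i\<bar>" using i by simp
  also have "\<dots> \<le> infnorm (A *v X)"
    by (subst infnorm_eq_Max) (rule Max_ge, auto)
  finally have "infnorm (A *v X) = ?M" by (rule antisym[OF le[OF X]])
  with X show "\<exists>X. infnorm X = 1 \<and> infnorm (A *v X) = ?M" by blast
qed

lemma inf_norm_matrix_row_sum:
  fixes A :: "real^'a::finite^'b::finite"
  shows "inf_norm_matrix A = Max (range (\<lambda>i. \<Sum>j\<in>UNIV. \<bar>A $ i $ j\<bar>))"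
  unfolding inf_norm_matrix_def
proof (rule cSup_eq_maximum)
  obtain X :: "real^'a" where "infnorm X = 1"
    and "infnorm (A *v X) = Max (range (\<lambda>i. \<Sum>j\<in>UNIV. \<bar>A $ i $ j\<bar>))"
    using row_sum_norming_vector(1) by blast
  then show "Max (range (\<lambda>i. \<Sum>j\<in>UNIV. \<bar>A $ i $ j\<bar>)) \<in> (\<lambda>X. infnorm (A *v X)) ` {X. infnorm X = 1}"
    by (metis (mono_tags, lifting) image_eqI mem_Collect_eq)
qed (use row_sum_norming_vector(2) in blast)

lemma inf_norm_matrix_attained:
  "\<exists>X. infnorm X = 1 \<and> infnorm (A *v X) = inf_norm_matrix A"
  unfolding inf_norm_matrix_row_sum by (rule row_sum_norming_vector(1))

end

theory Submission imports Defs begin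

text \<open>
  On a connected non-bipartite graph \<open>W X = 0\<close> forces \<open>X = 0\<close>: along edges the numbers
  \<open>x\<^sub>i / d\<^sub>i\<close> change sign and keep their absolute value, so a nonzero kernel vector would split the
  vertices by sign into a bipartition.  Hence the generalized inverses of \<open>W\<close> are its left inverses,
  and \<open>\<mu> \<parallel>X\<parallel>\<^sub>\<infinity> \<le> \<parallel>W X\<parallel>\<^sub>\<infinity>\<close> with \<open>\<mu> > 0\<close>.  Every left inverse satisfies
  \<open>1 = \<parallel>G W X\<parallel>\<^sub>\<infinity> \<le> \<parallel>G\<parallel> \<mu>\<close> at a minimizer \<open>X\<close>.  For a left inverse of norm at most \<open>1 / \<mu>\<close>, each row is
  a norm-preserving extension to \<open>\<real>\<^sup>m\<close> of the functional \<open>W X \<mapsto> x\<^sub>i\<close>; the extension comes from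
  separating its coefficient vector from the compact convex image of an \<open>\<ell>\<^sub>1\<close> ball.
\<close>

section \<open>Left inverses of minimal norm\<close>

lemma infnorm_attained: "\<exists>i. \<bar>x $ i\<bar> = infnorm (x :: real^'c::finite)"
proof -
  have "Max (range (\<lambda>i. \<bar>x $ i\<bar>)) \<in> range (\<lambda>i. \<bar>x $ i\<bar>)" by (rule Max_in) auto
  then obtain i where "Max (range (\<lambda>i. \<bar>x $ i\<bar>)) = \<bar>x $ i\<bar>" by (rule imageE)
  then have "\<bar>x $ i\<bar> = infnorm x" by (simp only: infnorm_eq_Max)
  then show ?thesis ..
qed

lemma infnorm_mult_le: "infnorm (A *v X) \<le> inf_norm_matrix A * infnorm X"
proof (cases "X = 0")
  case True
  then show ?thesis by (simp add: infnorm_0)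
next
  case False
  then have pos: "infnorm X > 0" by (simp add: infnorm_pos_lt)
  let ?Y = "(1 / infnorm X) *\<^sub>R X"
  have "infnorm ?Y = 1" using pos by (simp add: infnorm_mul)
  then have "infnorm (A *v ?Y) \<le> inf_norm_matrix A"
    unfolding inf_norm_matrix_row_sum by (rule row_sum_norming_vector(2))
  then show ?thesis
    using pos by (simp add: matrix_vector_mult_scaleR infnorm_mul field_simps)
qed

text \<open>Finite-dimensional Hahn-Banach. By \<open>dom\<close>, sending \<open>A *v X\<close> to
  the inner product of \<open>c\<close> and \<open>X\<close> is a well-defined functional on the
  range of \<open>A\<close>, of norm at most \<open>K\<close>; \<open>g\<close> represents an
  extension to the whole space, where the dual of \<open>infnorm\<close> is the l1 norm.\<close>

lemma dominated_functional_extension: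
  fixes A :: "real^'c::finite^'r::finite" and c :: "real^'c"
  assumes K: "K \<ge> 0" and dom: "\<And>X. \<bar>c \<bullet> X\<bar> \<le> K * infnorm (A *v X)"
  shows "\<exists>g. g v* A = c \<and> (\<Sum>j\<in>UNIV. \<bar>g $ j\<bar>) \<le> K"
proof (rule ccontr)
  define B :: "(real^'r) set" where "B = {g. (\<Sum>j\<in>UNIV. \<bar>g $ j\<bar>) \<le> K}"
  assume "\<not> ?thesis"
  then have notin: "c \<notin> (\<lambda>g. g v* A) ` B" by (auto simp: B_def)
  have lin: "linear (\<lambda>g. g v* A)"
    by (rule linearI) (simp_all add: vector_matrix_left_distrib scaleR_vector_matrix_assoc)
  have "bounded B"
    unfolding bounded_iff B_def using norm_le_l1_cart order_trans by blast
  moreover have "closed B"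
    unfolding B_def by (intro closed_Collect_le continuous_intros)
  ultimately have "compact B" by (simp add: compact_eq_bounded_closed)
  then have "closed ((\<lambda>g. g v* A) ` B)"
    by (intro compact_imp_closed compact_continuous_image linear_continuous_on
        linear_conv_bounded_linear[THEN iffD1] lin)
  moreover have "convex B"
  proof (rule convexI)
    fix x y :: "real^'r" and u v :: real
    assume xy: "x \<in> B" "y \<in> B" and uv: "0 \<le> u" "0 \<le> v" "u + v = 1"
    have "(\<Sum>j\<in>UNIV. \<bar>(u *\<^sub>R x + v *\<^sub>R y) $ j\<bar>) \<le> (\<Sum>j\<in>UNIV. u * \<bar>x $ j\<bar> + v * \<bar>y $ j\<bar>)"
      by (intro sum_mono) (use uv in \<open>simp add: abs_mult order_trans[OF abs_triangle_ineq]\<close>)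
    also have "\<dots> = u * (\<Sum>j\<in>UNIV. \<bar>x $ j\<bar>) + v * (\<Sum>j\<in>UNIV. \<bar>y $ j\<bar>)"
      by (simp add: sum.distrib sum_distrib_left)
    also have "\<dots> \<le> u * K + v * K"
      using xy uv unfolding B_def by (intro add_mono mult_left_mono) auto
    also have "\<dots> = K" using uv by (simp flip: distrib_right)
    finally show "u *\<^sub>R x + v *\<^sub>R y \<in> B" by (simp add: B_def)
  qed
  then have "convex ((\<lambda>g. g v* A) ` B)" by (rule convex_linear_image[OF lin])
  ultimately obtain a b where ab: "a \<bullet> c < b" "\<And>g. g \<in> B \<Longrightarrow> b < a \<bullet> (g v* A)"
    using separating_hyperplane_closed_point[of "(\<lambda>g. g v* A) ` B" c] notin by blast
  \<comment> \<open>On the l1 ball of radius \<open>K\<close> the linear form given by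
    \<open>A *v a\<close> is smallest at a signed multiple of a unit vector, in a coordinate where
    \<open>A *v a\<close> is largest in absolute value. Testing the separation there gives a bound
    that violates \<open>dom\<close> at \<open>a\<close>.\<close>
  obtain j where j: "\<bar>(A *v a) $ j\<bar> = infnorm (A *v a)" using infnorm_attained by blast
  define g :: "real^'r" where "g = axis j (- K * sgn ((A *v a) $ j))"
  have "(\<Sum>i\<in>UNIV. \<bar>g $ i\<bar>) = (\<Sum>i\<in>UNIV. if i = j then \<bar>K * sgn ((A *v a) $ j)\<bar> else 0)"
    by (intro sum.cong) (auto simp: g_def axis_def)
  also have "\<dots> \<le> K" using K by (simp add: abs_mult sgn_if)
  finally have "g \<in> B" by (simp add: B_def)
  then have "b < g \<bullet> (A *v a)"
    using ab(2) by (simp add: inner_commute[of a] dot_lmul_matrix)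
  also have "\<dots> = - K * infnorm (A *v a)"
    by (simp add: g_def inner_axis' flip: j) (simp add: sgn_if abs_if)
  finally have "a \<bullet> c < - (K * infnorm (A *v a))" using ab(1) by simp
  then show False using dom[of a] by (simp add: inner_commute[of a])
qed

text \<open>The matrix norm is the largest l1 norm of a row, so the rows of \<open>G\<close> can be
  chosen independently: row \<open>i\<close> extends the functional that recovers coordinate
  \<open>i\<close> of \<open>X\<close> from \<open>W *v X\<close>.\<close>

lemma bounded_below_left_inverse:
  fixes W :: "real^'n::finite^'m::finite"
  assumes c: "c > 0" and below: "\<And>X. c * infnorm X \<le> infnorm (W *v X)"
  shows "\<exists>G. G ** W = mat 1 \<and> inf_norm_matrix G \<le> 1 / c"
proof -
  have "\<exists>g. g v* W = axis i 1 \<and> (\<Sum>j\<in>UNIV. \<bar>g $ j\<bar>) \<le> 1 / c" for i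
  proof (rule dominated_functional_extension)
    fix X :: "real^'n"
    have "\<bar>axis i 1 \<bullet> X\<bar> \<le> infnorm X"
      by (simp add: inner_axis' component_le_infnorm_cart)
    also have "\<dots> \<le> 1 / c * infnorm (W *v X)"
      using c below[of X] by (simp add: field_simps)
    finally show "\<bar>axis i 1 \<bullet> X\<bar> \<le> 1 / c * infnorm (W *v X)" .
  qed (use c in simp)
  then obtain g where g: "\<And>i. g i v* W = axis i 1" "\<And>i. (\<Sum>j\<in>UNIV. \<bar>g i $ j\<bar>) \<le> 1 / c"
    by metis
  define G where "G = (\<chi> i. g i)"
  have "(G ** W) $ i = g i v* W" for i
    by (simp add: G_def matrix_matrix_mult_def vector_matrix_mult_def vec_eq_iff mult.commute)
  then have "G ** W = mat 1"
    by (auto simp: g vec_eq_iff mat_def axis_def)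
  moreover have "inf_norm_matrix G \<le> 1 / c"
    unfolding inf_norm_matrix_row_sum by (subst Max_le_iff) (auto simp: G_def g)
  ultimately show ?thesis by blast
qed

lemma minimal_generalized_inverse:
  fixes W :: "real^'n::finite^'m::finite"
  assumes inj: "\<And>X. W *v X = 0 \<Longrightarrow> X = 0"
  shows "\<exists>c>0. is_minimum {infnorm (W *v X) | X. infnorm X = 1} c \<and>
    is_minimum {inf_norm_matrix G | G. W ** G ** W = W} (1 / c)"
proof -
  let ?S = "{X :: real^'n. infnorm X = 1}"
  have "bounded ?S"
    \<comment> \<open>\<open>bounded\<close> refers to the Euclidean norm, which exceeds
      \<open>infnorm\<close> by at most this factor.\<close>
    unfolding bounded_iff by (rule exI[of _ "sqrt DIM(real^'n)"])
      (metis norm_le_infnorm mem_Collect_eq mult.right_neutral)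
  moreover have "closed ?S" by (intro closed_Collect_eq continuous_intros)
  ultimately have "compact ?S" by (simp add: compact_eq_bounded_closed)
  moreover have "?S \<noteq> {}" using row_sum_norming_vector(1) by blast
  moreover have "continuous_on ?S (\<lambda>X. infnorm (W *v X))"
    by (intro continuous_intros matrix_vector_mult_linear_continuous_on)
  ultimately obtain X0 where X0: "infnorm X0 = 1"
    and min: "\<And>X. infnorm X = 1 \<Longrightarrow> infnorm (W *v X0) \<le> infnorm (W *v X)"
    using continuous_attains_inf[of ?S "\<lambda>X. infnorm (W *v X)"] by blast
  define c where "c = infnorm (W *v X0)"
  have "X0 \<noteq> 0" using X0 by (auto simp: infnorm_0)
  then have c: "c > 0" using inj unfolding c_def infnorm_pos_lt by blast
  have below: "c * infnorm X \<le> infnorm (W *v X)" for X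
  proof (cases "X = 0")
    case False
    then have pos: "infnorm X > 0" by (simp add: infnorm_pos_lt)
    then have "infnorm ((1 / infnorm X) *\<^sub>R X) = 1" by (simp add: infnorm_mul)
    from min[OF this] pos show ?thesis
      by (simp add: c_def matrix_vector_mult_scaleR infnorm_mul field_simps)
  qed (simp add: infnorm_0)
  have lower: "1 / c \<le> inf_norm_matrix G" if G: "W ** G ** W = W" for G
  proof -
    \<comment> \<open>Injectivity cancels the left \<open>W\<close> in
      \<open>W ** G ** W = W\<close>, so \<open>G\<close> undoes \<open>W\<close> at the minimizer
      \<open>X0\<close>, and comparing norms there gives the bound.\<close>
    have "W *v (G *v (W *v X0) - X0) = 0"
      using G by (simp add: matrix_vector_mult_diff_distrib matrix_vector_mul_assoc matrix_mul_assoc)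
    then have "G *v (W *v X0) = X0" using inj by fastforce
    then have "1 \<le> inf_norm_matrix G * c"
      using infnorm_mult_le[of G "W *v X0"] X0 by (simp add: c_def)
    then show ?thesis using c by (simp add: field_simps)
  qed
  obtain G where G: "G ** W = mat 1" "inf_norm_matrix G \<le> 1 / c"
    using bounded_below_left_inverse[OF c below] by blast
  then have WGW: "W ** G ** W = W" by (simp flip: matrix_mul_assoc)
  then have "1 / c = inf_norm_matrix G" using G(2) lower by (intro antisym)
  with WGW lower have "is_minimum {inf_norm_matrix G | G. W ** G ** W = W} (1 / c)"
    unfolding is_minimum_def by blast
  moreover have "is_minimum {infnorm (W *v X) | X. infnorm X = 1} c"
    unfolding is_minimum_def using X0 min c_def by auto
  ultimately show ?thesis using c by blast
qed

section \<open>The weighted incidence matrix\<close>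

text \<open>\<open>matrix_inv\<close> is a choice among two-sided inverses, so an explicit inverse
  has to be identified with the chosen one.\<close>

lemma matrix_inv_unique:
  fixes A :: "real^'n::finite^'n" and B :: "real^'n^'n"
  assumes "A ** B = mat 1" "B ** A = mat 1"
  shows "matrix_inv A = B"
proof -
  have "A ** matrix_inv A = mat 1 \<and> matrix_inv A ** A = mat 1"
    unfolding matrix_inv_def by (rule someI[of _ B]) (use assms in simp)
  then have "B ** (A ** matrix_inv A) = B" by simp
  then show ?thesis by (simp add: matrix_mul_assoc assms(2))
qed

lemma matrix_inv_diagonal:
  fixes d :: "'n::finite \<Rightarrow> real"
  assumes "\<And>i. d i \<noteq> 0"
  shows "matrix_inv (\<chi> i j. if i = j then d i else 0) = (\<chi> i j. if i = j then 1 / d i else 0)"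
  by (rule matrix_inv_unique)
    (use assms in \<open>auto simp: matrix_matrix_mult_def mat_def vec_eq_iff if_distrib[of "\<lambda>x. x * _"] cong: if_cong\<close>)

lemma weighted_incidence_matrix_mult_nth:
  fixes e :: "'m::finite \<Rightarrow> 'v::finite set"
  assumes "\<And>v. vertex_degree (range e) v \<noteq> 0"
  shows "(weighted_incidence_matrix e *v X) $ i = (\<Sum>j\<in>e i. X $ j / vertex_degree (range e) j)"
proof -
  have inv: "matrix_inv (degree_matrix (range e)) =
      (\<chi> i j. if i = j then 1 / real (vertex_degree (range e) i) else 0)"
    unfolding degree_matrix_def by (rule matrix_inv_diagonal) (use assms in simp)
  have "weighted_incidence_matrix e $ i $ j =
      (if j \<in> e i then 1 / vertex_degree (range e) j else 0)" for i j
    unfolding weighted_incidence_matrix_def inv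
    by (simp add: incidence_matrix_def matrix_matrix_mult_def if_distrib[of "\<lambda>x. _ * x"] cong: if_cong)
  then show ?thesis
    by (simp add: matrix_vector_mult_def if_distrib[of "\<lambda>x. x * _"] sum.If_cases cong: if_cong)
qed

text \<open>Some edge has an endpoint other than \<open>u\<close>, and a path from \<open>u\<close>
  to it starts with an edge at \<open>u\<close>. The assumption \<open>E \<noteq> {}\<close>
  excludes the edgeless graph on one vertex.\<close>

lemma vertex_degree_pos:
  assumes "simple_graph E" "connected_graph E" "E \<noteq> {}"
  shows "vertex_degree E u > 0"
proof -
  from assms(3) obtain f where "f \<in> E" by blast
  with assms(1) have "card f = 2" by (simp add: simple_graph_def)
  then obtain a b where "f = {a, b}" "a \<noteq> b" by (auto simp: card_2_iff)
  then have "a \<noteq> u \<or> b \<noteq> u" by auto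
  then obtain w where w: "w \<noteq> u" by blast
  have "(u, w) \<in> {(a, b). {a, b} \<in> E}\<^sup>*"
    using assms(2) by (simp add: connected_graph_def)
  then obtain y where "{u, y} \<in> E" using w by (cases rule: converse_rtranclE) auto
  then have "{f \<in> E. u \<in> f} \<noteq> {}" by blast
  then show ?thesis by (simp add: vertex_degree_def card_gt_0_iff)
qed

lemma edge_antisymmetric_imp_zero:
  fixes y :: "'v::finite \<Rightarrow> real"
  assumes "simple_graph E" "connected_graph E" "\<not> bipartite_graph E"
    and edge: "\<And>i j. {i, j} \<in> E \<Longrightarrow> y i + y j = 0"
  shows "y v = 0"
proof (rule ccontr)
  assume v: "y v \<noteq> 0"
  \<comment> \<open>Induction along a path from \<open>v\<close>. Thus \<open>y\<close> has no
    zeros, and its sign is defined at every vertex and flips across each edge.\<close>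
  have "\<bar>y w\<bar> = \<bar>y v\<bar>" for w
  proof -
    have "(v, w) \<in> {(a, b). {a, b} \<in> E}\<^sup>*" using assms(2) by (simp add: connected_graph_def)
    then show ?thesis by induction (auto dest!: edge)
  qed
  then have nz: "y w \<noteq> 0" for w using v by (metis abs_eq_0)
  have "bipartite_graph E"
    unfolding bipartite_graph_def
  proof (intro exI conjI ballI)
    show "{w. y w > 0} \<union> {w. y w < 0} = UNIV" using nz by (auto simp: neq_iff)
    show "{w. y w > 0} \<inter> {w. y w < 0} = {}" by auto
    fix f assume f: "f \<in> E"
    then obtain a b where ab: "f = {a, b}"
      using assms(1) by (auto simp: simple_graph_def card_2_iff)
    with f edge have "y a + y b = 0" by blast
    with nz[of a] consider "y a > 0" "y b < 0" | "y b > 0" "y a < 0" by linarith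
    then show "\<exists>p\<in>{w. y w > 0}. \<exists>q\<in>{w. y w < 0}. f = {p, q}"
      by cases (auto simp: ab insert_commute)
  qed
  with assms(3) show False by blast
qed

lemma weighted_incidence_matrix_mult_edge:
  assumes "simple_graph (range e)" "connected_graph (range e)" "e k = {i, j}"
  shows "(weighted_incidence_matrix e *v X) $ k =
    X $ i / vertex_degree (range e) i + X $ j / vertex_degree (range e) j"
proof -
  \<comment> \<open>\<open>range e\<close> is nonempty because index types are, so all degrees are
    positive and the degree matrix is invertible.\<close>
  have "vertex_degree (range e) v \<noteq> 0" for v
    using vertex_degree_pos[OF assms(1,2), of v] by blast
  note mult = weighted_incidence_matrix_mult_nth[of e, OF this]
  \<comment> \<open>Distinct endpoints are needed for the sum over \<open>{i, j}\<close> to have two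
    terms.\<close>
  have "card (e k) = 2" using assms(1) by (simp add: simple_graph_def)
  then have "i \<noteq> j" using assms(3) by auto
  then show ?thesis unfolding mult assms(3) by simp
qed

lemma weighted_incidence_matrix_kernel:
  assumes graph: "simple_graph (range e)" "connected_graph (range e)" "\<not> bipartite_graph (range e)"
    and kernel: "weighted_incidence_matrix e *v X = 0"
  shows "X = 0"
proof -
  have "X $ v = 0" for v
  proof -
    have "X $ v / vertex_degree (range e) v = 0"
    proof (rule edge_antisymmetric_imp_zero[OF graph])
      fix i j assume "{i, j} \<in> range e"
      then obtain k where k: "e k = {i, j}" by (metis imageE)
      show "X $ i / vertex_degree (range e) i + X $ j / vertex_degree (range e) j = 0"
        using weighted_incidence_matrix_mult_edge[OF graph(1,2) k, of X] kernel by simp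
    qed
    moreover have "vertex_degree (range e) v > 0"
      by (rule vertex_degree_pos[OF graph(1,2)]) simp
    ultimately show ?thesis by simp
  qed
  then show ?thesis by (simp add: vec_eq_iff)
qed

text \<open>The two orderings of an edge give the same value, so ranging over ordered adjacent pairs
  yields exactly the absolute entries of \<open>W X\<close>.\<close>

lemma Max_edges_eq_infnorm:
  assumes graph: "simple_graph (range e)" "connected_graph (range e)"
  shows "Max {\<bar>X $ i / vertex_degree (range e) i + X $ j / vertex_degree (range e) j\<bar> | i j.
    {i, j} \<in> range e} = infnorm (weighted_incidence_matrix e *v X)"
    (is "Max ?S = infnorm ?WX")
proof -
  have "?S = range (\<lambda>k. \<bar>?WX $ k\<bar>)"
  proof (intro equalityI subsetI)
    fix r assume "r \<in> ?S"
    then obtain i j where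
      r: "r = \<bar>X $ i / vertex_degree (range e) i + X $ j / vertex_degree (range e) j\<bar>"
      and "{i, j} \<in> range e" by blast
    then obtain k where k: "e k = {i, j}" by (metis imageE)
    have "r = \<bar>?WX $ k\<bar>"
      unfolding r weighted_incidence_matrix_mult_edge[OF graph k] ..
    then show "r \<in> range (\<lambda>k. \<bar>?WX $ k\<bar>)" by blast
  next
    fix r assume "r \<in> range (\<lambda>k. \<bar>?WX $ k\<bar>)"
    then obtain k where r: "r = \<bar>?WX $ k\<bar>" by blast
    have "card (e k) = 2" using graph(1) by (simp add: simple_graph_def)
    then obtain i j where k: "e k = {i, j}" by (auto simp: card_2_iff)
    then have "{i, j} \<in> range e" by (metis rangeI)
    then show "r \<in> ?S"
      unfolding r weighted_incidence_matrix_mult_edge[OF graph k] by blast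
  qed
  then show ?thesis by (simp add: infnorm_eq_Max)
qed

lemma is_minimum_imp_Inf: "is_minimum S a \<Longrightarrow> Inf S = a"
  unfolding is_minimum_def by (rule cInf_eq_minimum) auto

lemma mu_infinity_eq_Inf:
  assumes graph: "simple_graph (range e)" "connected_graph (range e)"
  shows "mu_infinity (range e) = Inf {infnorm (weighted_incidence_matrix e *v X) | X. infnorm X = 1}"
  unfolding mu_infinity_def Max_edges_eq_infnorm[OF graph] by (simp add: setcompr_eq_image)

lemma weighted_incidence_matrix_minima:
  fixes e :: "'m::finite \<Rightarrow> 'v::finite set" and W :: "real^'v^'m"
  assumes graph: "simple_graph (range e)" "connected_graph (range e)" "\<not> bipartite_graph (range e)"
    and W: "W = weighted_incidence_matrix e"
  shows "\<exists>c>0. mu_infinity (range e) = c \<and>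
    is_minimum {infnorm (W *v X) | X. infnorm X = 1} c \<and>
    is_minimum {inf_norm_matrix G | G. W ** G ** W = W} (1 / c)"
proof -
  obtain c where "c > 0" and min: "is_minimum {infnorm (W *v X) | X. infnorm X = 1} c"
    and "is_minimum {inf_norm_matrix G | G. W ** G ** W = W} (1 / c)"
    using minimal_generalized_inverse[OF weighted_incidence_matrix_kernel[OF graph, folded W]] by blast
  \<comment> \<open>\<open>mu_infinity\<close> is an infimum; the attained minimum identifies it
    with \<open>c\<close>.\<close>
  moreover have "mu_infinity (range e) = c"
    unfolding mu_infinity_eq_Inf[OF graph(1,2), folded W] by (rule is_minimum_imp_Inf[OF min])
  ultimately show ?thesis by blast
qed

theorem theorem3p1:
  fixes E :: "'v::finite set set"
    and e :: "'m::finite \<Rightarrow> 'v set"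
    and W :: "real^'v^'m"
  assumes "simple_graph E"
    and "connected_graph E"
    and "\<not> bipartite_graph E"
    and "bij_betw e UNIV E"
    and "CARD('m) \<ge> CARD('v)"
    and "W = weighted_incidence_matrix e"
  shows "is_minimum {infnorm (W *v X) | X. infnorm X = 1} (mu_infinity E) \<and>
    (\<exists>g. is_minimum {inf_norm_matrix G | G :: real^'m^'v. W ** G ** W = W} g \<and>
      g \<noteq> 0 \<and> mu_infinity E = 1 / g)"
proof -
  \<comment> \<open>Surjectivity of the enumeration turns statements about \<open>range e\<close>
    into statements about \<open>E\<close>.\<close>
  have "range e = E" using assms(4) by (simp add: bij_betw_def)
  then obtain c where "c > 0" "mu_infinity E = c"
    "is_minimum {infnorm (W *v X) | X. infnorm X = 1} c"
    "is_minimum {inf_norm_matrix G | G. W ** G ** W = W} (1 / c)"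
    using weighted_incidence_matrix_minima[of e W] assms by blast
  then show ?thesis by (intro conjI exI[of _ "1 / c"]) simp_all
qed

end
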